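(* Let $\mathcal{X}$ be a Borel subset of $\mathbb{R}^{\mathbb{N}}$ or $\mathbb{C}^{\mathbb{N}}$ such that each coordinate $x_n$ ($n=1,2,3,\ldots$) takes only finitely many values as $x$ ranges over $\mathcal{X}$, and such that $\sum_n |x_n|^2=\infty$ for all $x\in\mathcal{X}$. For $k\ge1$ let $\operatorname{Proj}_k(\mathcal{X}):=\{(x_1,\ldots,x_k): x\in\mathcal{X}\}$. If $$\liminf_{k\to\infty}\frac{\log|\operatorname{Proj}_k(\mathcal{X})|}{\inf_{x\in\mathcal{X}}\sum_{n=1}^k|x_n|^2}<\frac18$$ then $\mathcal{X}$ admits detection.
   Context: Noise: $\xi=(\xi_n)_{n\in\mathbb{N}}$ is a sequence of independent standard Gaussian random variables: in the real case $\xi_n\sim N(0,1)$; in the complex case the real and imaginary parts of $\xi_n$ are independent and each distributed as $N(0,1)$. With $\mathbb{K}=\mathbb{R}$ or $\mathbb{C}$ accordingly, a set $\mathcal{X}\subset\mathbb{K}^{\mathbb{N}}$ admits detection if there is a Borel measurable map $T:\mathbb{K}^{\mathbb{N}}\to\{0,1\}$ (product topology) such that $T(\xi)=0$ almost surely and, for every $x\in\mathcal{X}$, $T(x+\xi)=1$ almost surely. $|\cdot|$ of a finite set is its cardinality; a quotient with zero denominator is read as $+\infty$. *)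

theory Defs
  imports "HOL-Probability.Probability"
begin

text \<open>
  Sequences are functions on \<^typ>\<open>nat\<close> and hence start at index 0: the value \<open>x n\<close> is the
  mathematical coordinate \<open>x\<^sub>n\<^sub>+\<^sub>1\<close>, and the first \<open>k\<close> coordinates are those with index in \<open>{..<k}\<close>.
  On \<open>nat \<Rightarrow> 'a\<close> the measure \<^const>\<open>borel\<close> refers to the product topology.
\<close>

definition real_gaussian_noise :: "'w measure \<Rightarrow> (nat \<Rightarrow> 'w \<Rightarrow> real) \<Rightarrow> bool" where
  "real_gaussian_noise M \<xi> \<longleftrightarrow>
     prob_space M \<and>
     prob_space.indep_vars M (\<lambda>_. borel) \<xi> UNIV \<and>
     (\<forall>n. distributed M lborel (\<xi> n) std_normal_density)"

text \<open>Both the real and the imaginary part have variance 1, so \<open>E |\<xi>\<^sub>n|\<^sup>2 = 2\<close>.\<close>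

definition complex_gaussian_noise :: "'w measure \<Rightarrow> (nat \<Rightarrow> 'w \<Rightarrow> complex) \<Rightarrow> bool" where
  "complex_gaussian_noise M \<xi> \<longleftrightarrow>
     prob_space M \<and>
     prob_space.indep_vars M (\<lambda>_. borel) \<xi> UNIV \<and>
     (\<forall>n. prob_space.indep_var M borel (\<lambda>\<omega>. Re (\<xi> n \<omega>)) borel (\<lambda>\<omega>. Im (\<xi> n \<omega>)) \<and>
          distributed M lborel (\<lambda>\<omega>. Re (\<xi> n \<omega>)) std_normal_density \<and>
          distributed M lborel (\<lambda>\<omega>. Im (\<xi> n \<omega>)) std_normal_density)"

definition admits_detection ::
  "'w measure \<Rightarrow> (nat \<Rightarrow> 'w \<Rightarrow> 'a::real_normed_vector) \<Rightarrow> (nat \<Rightarrow> 'a) set \<Rightarrow> bool" where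
  "admits_detection M \<xi> X \<longleftrightarrow>
     (\<exists>T \<in> borel \<rightarrow>\<^sub>M count_space {0, 1::nat}.
        (AE \<omega> in M. T (\<lambda>n. \<xi> n \<omega>) = 0) \<and>
        (\<forall>x\<in>X. AE \<omega> in M. T (\<lambda>n. x n + \<xi> n \<omega>) = 1))"

definition Proj :: "nat \<Rightarrow> (nat \<Rightarrow> 'a) set \<Rightarrow> (nat \<Rightarrow> 'a) set" where
  "Proj k X = (\<lambda>x. restrict x {..<k}) ` X"

definition min_energy :: "(nat \<Rightarrow> 'a::real_normed_vector) set \<Rightarrow> nat \<Rightarrow> real" where
  "min_energy X k = (INF x\<in>X. \<Sum>n<k. (norm (x n))\<^sup>2)"

text \<open>
  A quotient with denominator 0 (including 0/0) is read as \<open>\<infinity>\<close>; the case distinction is needed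
  because division by 0 yields 0 in \<^typ>\<open>real\<close>.
\<close>

definition entropy_energy_ratio :: "(nat \<Rightarrow> 'a::real_normed_vector) set \<Rightarrow> nat \<Rightarrow> ereal" where
  "entropy_energy_ratio X k =
     (if min_energy X k = 0 then \<infinity>
      else ereal (ln (real (card (Proj k X))) / min_energy X k))"

end

theory Submission
  imports Defs
begin

text \<open>
  Correlate the first \<open>k\<close> coordinates of the data with every point of \<open>Proj k X\<close>, and raise an alarm
  if for some \<open>p\<close> the correlation reaches half the energy of \<open>p\<close>. Chernoff's bound makes both the
  false alarm caused by one \<open>p\<close> and the miss of the true signal \<open>p\<close> no more likely than
  \<open>exp (- energy p / 8)\<close>, so that the total error is governed by \<open>card (Proj k X) * exp (- min_energy X k / 8)\<close>.
  On the indices \<open>k\<close> at which the ratio stays below some \<open>c < 1/8\<close>, the minimal energy is unbounded: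
  otherwise the projections would have bounded cardinality, \<open>X\<close> would be finite, and the minimal energy
  would tend to infinity after all. Hence the errors are summable along a subsequence, and
  Borel--Cantelli applies to the test that asks for infinitely many alarms.
\<close>

definition energy :: "nat \<Rightarrow> (nat \<Rightarrow> 'a::real_inner) \<Rightarrow> real" where
  "energy k x = (\<Sum>n<k. (norm (x n))\<^sup>2)"

text \<open>\<open>inner\<close> is the real inner product; over the complex numbers it is the real
  part of the Hermitian product, so one argument covers both fields.\<close>

definition correlation :: "nat \<Rightarrow> (nat \<Rightarrow> 'a::real_inner) \<Rightarrow> (nat \<Rightarrow> 'a) \<Rightarrow> real" where
  "correlation k x y = (\<Sum>n<k. inner (x n) (y n))"

definition alarm :: "(nat \<Rightarrow> 'a::real_inner) set \<Rightarrow> nat \<Rightarrow> (nat \<Rightarrow> 'a) set" where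
  "alarm X k = {y. \<exists>p\<in>Proj k X. energy k p / 2 \<le> correlation k p y}"

subsection \<open>Gaussian noise\<close>

text \<open>The moment generating function of a standard Gaussian vector, free of coordinates. It
  fits complex noise because the real and imaginary parts each have variance 1. The nonnegative
  integral avoids integrability side conditions.\<close>

definition gaussian_mgf :: "'w measure \<Rightarrow> ('w \<Rightarrow> 'a::real_inner) \<Rightarrow> bool" where
  "gaussian_mgf M Y \<longleftrightarrow>
     (\<forall>v. (\<integral>\<^sup>+\<omega>. ennreal (exp (inner v (Y \<omega>))) \<partial>M) = ennreal (exp ((norm v)\<^sup>2 / 2)))"

lemma nn_integral_exp_std_normal:
  assumes "distributed M lborel Y std_normal_density"
  shows "(\<integral>\<^sup>+\<omega>. ennreal (exp (v * Y \<omega>)) \<partial>M) = ennreal (exp (v\<^sup>2 / 2))"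
proof -
  \<comment> \<open>Completing the square: tilting the standard density by exp(v x) gives, up to the
    factor exp(v^2/2), the normal density with mean v, whose mass is 1.\<close>
  have shift: "std_normal_density x * exp (v * x) = exp (v\<^sup>2 / 2) * normal_density v 1 x" for x
    by (simp add: normal_density_def mult_exp_exp power2_eq_square field_simps)
  interpret N: prob_space "density lborel (normal_density v 1)"
    by (rule prob_space_normal_density) simp
  have "(\<integral>\<^sup>+x. ennreal (normal_density v 1 x) \<partial>lborel) = 1"
    using N.emeasure_space_1 by (simp add: emeasure_density)
  moreover have "(\<integral>\<^sup>+\<omega>. ennreal (exp (v * Y \<omega>)) \<partial>M) =
      (\<integral>\<^sup>+x. ennreal (std_normal_density x) * ennreal (exp (v * x)) \<partial>lborel)"
    by (rule distributed_nn_integral[OF assms, symmetric]) measurable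
  ultimately show ?thesis
    by (simp add: ennreal_mult[symmetric] shift) (simp add: ennreal_mult nn_integral_cmult)
qed

lemma gaussian_mgf_real:
  assumes "distributed M lborel Y std_normal_density"
  shows "gaussian_mgf M Y"
  unfolding gaussian_mgf_def using nn_integral_exp_std_normal[OF assms] by simp

lemma gaussian_mgf_complex:
  assumes "prob_space M"
    and indep: "prob_space.indep_var M borel (\<lambda>\<omega>. Re (Y \<omega>)) borel (\<lambda>\<omega>. Im (Y \<omega>))"
    and Re: "distributed M lborel (\<lambda>\<omega>. Re (Y \<omega>)) std_normal_density"
    and Im: "distributed M lborel (\<lambda>\<omega>. Im (Y \<omega>)) std_normal_density"
  shows "gaussian_mgf M Y"
  unfolding gaussian_mgf_def
proof
  fix v :: complex
  interpret prob_space M by fact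
  \<comment> \<open>The real inner product splits into Re v Re Y + Im v Im Y. Indexing the two
    exponential factors by booleans matches the definition of \<open>indep_var\<close>, so the
    integral of their product factorises.\<close>
  let ?F = "\<lambda>b \<omega>. ennreal (exp (case_bool (Re v) (Im v) b * case_bool (Re (Y \<omega>)) (Im (Y \<omega>)) b))"
  have prod_F: "(\<Prod>b\<in>UNIV. ?F b \<omega>) = ennreal (exp (inner v (Y \<omega>)))" for \<omega>
    by (simp add: UNIV_bool ennreal_mult[symmetric] mult_exp_exp inner_complex_def add.commute)
  have case_bool_borel: "case_bool borel borel = (\<lambda>_. borel)"
    by (auto split: bool.split)
  have "indep_vars (\<lambda>b. borel) (\<lambda>b \<omega>. case_bool (\<lambda>\<omega>. Re (Y \<omega>)) (\<lambda>\<omega>. Im (Y \<omega>)) b \<omega>) UNIV"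
    using indep unfolding indep_var_def by (simp add: case_bool_borel)
  then have "indep_vars (\<lambda>b. borel)
      (\<lambda>b \<omega>. ennreal (exp (case_bool (Re v) (Im v) b * case_bool (\<lambda>\<omega>. Re (Y \<omega>)) (\<lambda>\<omega>. Im (Y \<omega>)) b \<omega>))) UNIV"
    by (rule indep_vars_compose2) measurable
  moreover have "case_bool (\<lambda>\<omega>. Re (Y \<omega>)) (\<lambda>\<omega>. Im (Y \<omega>)) b \<omega> = case_bool (Re (Y \<omega>)) (Im (Y \<omega>)) b" for b \<omega>
    by (cases b) auto
  ultimately have "indep_vars (\<lambda>b. borel) ?F UNIV"
    by simp
  then have "(\<integral>\<^sup>+\<omega>. (\<Prod>b\<in>UNIV. ?F b \<omega>) \<partial>M) = (\<Prod>b\<in>UNIV. \<integral>\<^sup>+\<omega>. ?F b \<omega> \<partial>M)"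
    by (intro indep_vars_nn_integral) auto
  also have "(\<Prod>b\<in>UNIV. \<integral>\<^sup>+\<omega>. ?F b \<omega> \<partial>M) = ennreal (exp ((norm v)\<^sup>2 / 2))"
    by (simp add: UNIV_bool nn_integral_exp_std_normal[OF Re] nn_integral_exp_std_normal[OF Im]
        ennreal_mult[symmetric] mult_exp_exp cmod_power2 add_divide_distrib add.commute)
  finally show "(\<integral>\<^sup>+\<omega>. ennreal (exp (inner v (Y \<omega>))) \<partial>M) = ennreal (exp ((norm v)\<^sup>2 / 2))"
    unfolding prod_F .
qed

section \<open>Energy, correlation and the Gaussian tail bound\<close>

lemma energy_nonneg: "0 \<le> energy k x"
  by (simp add: energy_def sum_nonneg)

lemma energy_mono: "k \<le> l \<Longrightarrow> energy k x \<le> energy l x"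
  unfolding energy_def by (intro sum_mono2) auto

lemma energy_restrict: "energy k (restrict x {..<k}) = energy k x"
  by (simp add: energy_def)

lemma correlation_restrict: "correlation k (restrict x {..<k}) y = correlation k x y"
  by (simp add: correlation_def)

lemma correlation_add_self: "correlation k x (\<lambda>n. x n + y n) = energy k x + correlation k x y"
  by (simp add: correlation_def energy_def inner_add_right sum.distrib power2_norm_eq_inner)

lemma correlation_minus: "correlation k (\<lambda>n. - x n) y = - correlation k x y"
  by (simp add: correlation_def sum_negf)

lemma energy_minus: "energy k (\<lambda>n. - x n) = energy k x"
  by (simp add: energy_def)

lemma borel_measurable_correlation:
  fixes Y :: "nat \<Rightarrow> 'w \<Rightarrow> 'a::euclidean_space"
  assumes "\<And>n. Y n \<in> borel_measurable M"
  shows "(\<lambda>\<omega>. correlation k p (\<lambda>n. Y n \<omega>)) \<in> borel_measurable M"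
  unfolding correlation_def using assms by measurable

text \<open>A finite union of sets, each cut out by an inequality between continuous functions in
  the product topology; this is what later makes the test Borel.\<close>

lemma closed_alarm:
  assumes "finite (Proj k X)"
  shows "closed (alarm X k)"
proof -
  have "closed {y. energy k p / 2 \<le> correlation k p y}" for p
    unfolding correlation_def by (intro closed_Collect_le continuous_intros) auto
  moreover have "alarm X k = (\<Union>p\<in>Proj k X. {y. energy k p / 2 \<le> correlation k p y})"
    by (auto simp: alarm_def)
  ultimately show ?thesis
    using assms by (auto intro!: closed_UN)
qed

text \<open>Chernoff's bound. With E the energy of \<open>p\<close>, a parameter s > 0 gives exp(s^2
  E/2 - s E/2), which is smallest at s = 1/2. This is the origin of the constant 1/8.\<close>

lemma correlation_tail:
  fixes \<xi> :: "nat \<Rightarrow> 'w \<Rightarrow> 'a::euclidean_space"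
  assumes "prob_space M"
    and indep: "prob_space.indep_vars M (\<lambda>_. borel) \<xi> UNIV"
    and mgf: "\<And>n. gaussian_mgf M (\<xi> n)"
  shows "measure M {\<omega>\<in>space M. energy k p / 2 \<le> correlation k p (\<lambda>n. \<xi> n \<omega>)} \<le> exp (- energy k p / 8)"
proof -
  interpret prob_space M by fact
  have meas[measurable]: "\<xi> n \<in> borel_measurable M" for n
    using indep by (auto simp: indep_vars_def)
  note borel_measurable_correlation[of \<xi> M, OF meas, measurable]
  have indep': "indep_vars (\<lambda>_. borel) (\<lambda>n \<omega>. ennreal (exp (inner (p n /\<^sub>R 2) (\<xi> n \<omega>)))) {..<k}"
    by (rule indep_vars_compose2[OF indep_vars_subset[OF indep]]) auto
  have "(\<integral>\<^sup>+\<omega>. ennreal (exp (1/2 * correlation k p (\<lambda>n. \<xi> n \<omega>))) * indicator (space M) \<omega> \<partial>M) =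
      (\<integral>\<^sup>+\<omega>. (\<Prod>n<k. ennreal (exp (inner (p n /\<^sub>R 2) (\<xi> n \<omega>)))) \<partial>M)"
    by (intro nn_integral_cong)
       (simp add: correlation_def prod_ennreal exp_sum[symmetric] sum_divide_distrib)
  also have "\<dots> = (\<Prod>n<k. \<integral>\<^sup>+\<omega>. ennreal (exp (inner (p n /\<^sub>R 2) (\<xi> n \<omega>))) \<partial>M)"
    by (rule indep_vars_nn_integral[OF _ indep']) auto
  also have "\<dots> = (\<Prod>n<k. ennreal (exp ((norm (p n /\<^sub>R 2))\<^sup>2 / 2)))"
    by (simp only: mgf[unfolded gaussian_mgf_def, rule_format])
  also have "\<dots> = ennreal (exp (energy k p / 8))"
    by (simp add: prod_ennreal exp_sum[symmetric] energy_def sum_divide_distrib power_divide)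
  finally have "emeasure M {\<omega>\<in>space M. energy k p / 2 \<le> correlation k p (\<lambda>n. \<xi> n \<omega>)} \<le>
      ennreal (exp (- (1/2) * (energy k p / 2))) * ennreal (exp (energy k p / 8))"
    using Chernoff_ineq_nn_integral_ge[of "1/2" "space M" M "\<lambda>\<omega>. correlation k p (\<lambda>n. \<xi> n \<omega>)" "energy k p / 2"]
    by simp
  also have "\<dots> = ennreal (exp (- energy k p / 8))"
    by (simp add: ennreal_mult[symmetric] mult_exp_exp)
  finally show ?thesis
    by (simp add: emeasure_eq_measure)
qed

subsection \<open>Projections and minimal energy\<close>

lemma finite_Proj:
  assumes "\<And>n. finite ((\<lambda>x. x n) ` X)"
  shows "finite (Proj k X)"
proof (rule finite_subset)
  show "Proj k X \<subseteq> (\<Pi>\<^sub>E n\<in>{..<k}. (\<lambda>x. x n) ` X)"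
    by (auto simp: Proj_def split: if_splits)
  show "finite (\<Pi>\<^sub>E n\<in>{..<k}. (\<lambda>x. x n) ` X)"
    using assms by (intro finite_PiE) auto
qed

lemma min_energy_alt: "min_energy X k = (INF x\<in>X. energy k x)"
  by (simp add: min_energy_def energy_def)

lemma min_energy_le: "x \<in> X \<Longrightarrow> min_energy X k \<le> energy k x"
  unfolding min_energy_alt by (rule cINF_lower) (auto intro: bdd_belowI2 energy_nonneg)

lemma min_energy_greatest: "X \<noteq> {} \<Longrightarrow> (\<And>x. x \<in> X \<Longrightarrow> b \<le> energy k x) \<Longrightarrow> b \<le> min_energy X k"
  unfolding min_energy_alt by (rule cINF_greatest)

lemma inj_on_restrict_lessThan:
  fixes F :: "(nat \<Rightarrow> 'a) set"
  assumes "finite F"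
  obtains K where "\<And>k. K \<le> k \<Longrightarrow> inj_on (\<lambda>x. restrict x {..<k}) F"
proof -
  define d where "d x y = (LEAST n. x n \<noteq> y n)" for x y :: "nat \<Rightarrow> 'a"
  \<comment> \<open>Past the first disagreement of every pair in \<open>F\<close>.
    \<open>Suc\<close> puts that disagreement strictly below \<open>k\<close>; the inserted 0 keeps
    \<open>Max\<close> meaningful for empty \<open>F\<close>. For x = y the value of
    \<open>d\<close> is arbitrary but harmless.\<close>
  define K where "K = Suc (Max (insert 0 ((\<lambda>(x, y). d x y) ` (F \<times> F))))"
  have "inj_on (\<lambda>x. restrict x {..<k}) F" if "K \<le> k" for k
  proof (rule inj_onI, rule ccontr)
    fix x y assume xy: "x \<in> F" "y \<in> F" "restrict x {..<k} = restrict y {..<k}" "x \<noteq> y"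
    have "d x y \<le> Max (insert 0 ((\<lambda>(x, y). d x y) ` (F \<times> F)))"
      using xy assms by (intro Max_ge) force+
    then have "d x y < k"
      using that by (simp add: K_def)
    then have "x (d x y) = y (d x y)"
      using fun_cong[OF xy(3), of "d x y"] by simp
    moreover obtain n where "x n \<noteq> y n"
      using xy(4) by auto
    then have "x (d x y) \<noteq> y (d x y)"
      unfolding d_def by (rule LeastI)
    ultimately show False by simp
  qed
  then show ?thesis by (rule that)
qed

text \<open>Otherwise m + 1 points of \<open>X\<close> would have distinct projections for all large
  \<open>k\<close>, among them one with at most m projections in total.\<close>

lemma finite_if_bounded_Proj:
  assumes fin: "\<And>k. finite (Proj k X)"
    and freq: "\<exists>\<^sub>F k in sequentially. card (Proj k X) \<le> m"
  shows "finite X"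
proof (rule ccontr)
  assume "infinite X"
  then obtain F where F: "F \<subseteq> X" "finite F" "card F = Suc m"
    using infinite_arbitrarily_large by blast
  obtain K where K: "\<And>k. K \<le> k \<Longrightarrow> inj_on (\<lambda>x. restrict x {..<k}) F"
    using inj_on_restrict_lessThan[OF F(2)] by blast
  obtain k where k: "K \<le> k" "card (Proj k X) \<le> m"
    using freq by (auto simp: frequently_sequentially)
  have "Suc m = card ((\<lambda>x. restrict x {..<k}) ` F)"
    using K[OF k(1)] F(3) by (simp add: card_image)
  also have "\<dots> \<le> card (Proj k X)"
    unfolding Proj_def using F(1) fin[of k] by (intro card_mono) (auto simp: Proj_def)
  finally show False using k(2) by simp
qed

section \<open>Indices of small ratio and large minimal energy\<close>

lemma energy_at_top:
  assumes "(\<Sum>n. ennreal ((norm (x n))\<^sup>2)) = \<infinity>"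
  shows "filterlim (\<lambda>k. energy k x) at_top sequentially"
  unfolding filterlim_at_top
proof
  fix b
  have "\<exists>k. b \<le> energy k x"
  proof (rule ccontr)
    assume "\<not> ?thesis"
    then have bound: "(\<Sum>n<k. (norm (x n))\<^sup>2) \<le> b" for k
      by (simp add: energy_def not_le less_imp_le)
    have "summable (\<lambda>n. (norm (x n))\<^sup>2)"
      by (rule bounded_imp_summable[of _ b]) (simp_all only: zero_le_power2 lessThan_Suc_atMost[symmetric] bound)
    then have "(\<Sum>n. ennreal ((norm (x n))\<^sup>2)) \<noteq> top"
      by (rule ennreal_suminf_neq_top) simp
    then show False
      using assms by (simp only: infinity_ennreal_def)
  qed
  then obtain k where "b \<le> energy k x" ..
  then show "\<forall>\<^sub>F k in sequentially. b \<le> energy k x"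
    unfolding eventually_sequentially by (meson energy_mono order_trans)
qed

text \<open>Finitely many eventual bounds hold simultaneously. For infinite \<open>X\<close> this
  can fail: points that vanish on ever longer initial segments keep the infimum at 0.\<close>

lemma min_energy_at_top:
  fixes X :: "(nat \<Rightarrow> 'a::real_inner) set"
  assumes "finite X" "X \<noteq> {}" "\<And>x. x \<in> X \<Longrightarrow> (\<Sum>n. ennreal ((norm (x n))\<^sup>2)) = \<infinity>"
  shows "\<forall>\<^sub>F k in sequentially. b \<le> min_energy X k"
proof -
  have "\<forall>\<^sub>F k in sequentially. \<forall>x\<in>X. b \<le> energy k x"
    using assms energy_at_top unfolding filterlim_at_top by (intro eventually_ball_finite) auto
  then show ?thesis
    by eventually_elim (use assms(2) in \<open>auto intro: min_energy_greatest\<close>)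
qed

lemma frequently_large_energy:
  fixes X :: "(nat \<Rightarrow> 'a::real_inner) set"
  assumes fin: "\<And>k. finite (Proj k X)" and "X \<noteq> {}"
    and inf: "\<And>x. x \<in> X \<Longrightarrow> (\<Sum>n. ennreal ((norm (x n))\<^sup>2)) = \<infinity>"
    and c: "0 \<le> c"
    and freq: "\<exists>\<^sub>F k in sequentially. ln (real (card (Proj k X))) \<le> c * min_energy X k"
  shows "\<exists>k. b \<le> min_energy X k \<and> ln (real (card (Proj k X))) \<le> c * min_energy X k"
proof (rule ccontr)
  assume small: "\<not> ?thesis"
  \<comment> \<open>A bound independent of \<open>k\<close>: at such an index the minimal energy is
    below \<open>b\<close>, so the logarithm is at most \<open>c * b\<close>.\<close>
  have "card (Proj k X) \<le> nat \<lceil>exp (c * b)\<rceil>"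
    if "ln (real (card (Proj k X))) \<le> c * min_energy X k" for k
  proof -
    have "min_energy X k \<le> b" using small that by force
    then have le: "ln (real (card (Proj k X))) \<le> c * b"
      using that c mult_left_mono[of "min_energy X k" b c] by linarith
    have "0 < card (Proj k X)"
      using fin[of k] \<open>X \<noteq> {}\<close> by (auto simp: card_gt_0_iff Proj_def)
    then have "real (card (Proj k X)) \<le> exp (c * b)"
      using le by (metis exp_le_cancel_iff exp_ln of_nat_0_less_iff)
    then show ?thesis by linarith
  qed
  then have "finite X"
    by (intro finite_if_bounded_Proj[OF fin] frequently_elim1[OF freq])
  from frequently_eventually_frequently[OF freq min_energy_at_top[OF this \<open>X \<noteq> {}\<close> inf, of b]]
  show False
    using small by (auto dest!: frequently_ex)
qed

lemma frequently_small_ratio: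
  fixes X :: "(nat \<Rightarrow> 'a::real_inner) set"
  assumes "liminf (entropy_energy_ratio X) < ereal a" "X \<noteq> {}" "0 < a" "\<And>k. finite (Proj k X)"
  obtains c where "0 \<le> c" "c < a"
    "\<exists>\<^sub>F k in sequentially. ln (real (card (Proj k X))) \<le> c * min_energy X k"
proof -
  \<comment> \<open>The maximum with 0 makes the chosen \<open>c\<close> nonnegative, as
    \<open>frequently_large_energy\<close> requires.\<close>
  have "max 0 (liminf (entropy_energy_ratio X)) < ereal a"
    using assms(1,3) by simp
  then obtain c where c: "max 0 (liminf (entropy_energy_ratio X)) < ereal c" "ereal c < ereal a"
    using ereal_dense2 by blast
  have "\<exists>\<^sub>F k in sequentially. entropy_energy_ratio X k < ereal c"
  proof (rule ccontr)
    assume "\<not> ?thesis"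
    then have "\<forall>\<^sub>F k in sequentially. ereal c \<le> entropy_energy_ratio X k"
      by (simp add: not_frequently not_less)
    then have "ereal c \<le> liminf (entropy_energy_ratio X)"
      by (rule Liminf_bounded)
    moreover have "liminf (entropy_energy_ratio X) < ereal c"
      using c(1) by (rule le_less_trans[OF max.cobounded2])
    ultimately show False
      by simp
  qed
  then have "\<exists>\<^sub>F k in sequentially. ln (real (card (Proj k X))) \<le> c * min_energy X k"
  proof (rule frequently_elim1)
    fix k assume lt: "entropy_energy_ratio X k < ereal c"
    have "0 \<le> min_energy X k"
      using assms(2) by (intro min_energy_greatest energy_nonneg)
    \<comment> \<open>A zero denominator makes the ratio infinite and contradicts \<open>lt\<close>;
      hence the minimal energy is positive and can be multiplied out.\<close>
    then show "ln (real (card (Proj k X))) \<le> c * min_energy X k"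
      using lt by (auto simp: entropy_energy_ratio_def field_simps split: if_splits)
  qed
  moreover have "0 \<le> c" "c < a" using c by auto
  ultimately show ?thesis using that by blast
qed

subsection \<open>The detector\<close>

text \<open>Union bound over \<open>Proj k X\<close>: every projection has at least the minimal
  energy, so one tail estimate serves all of them.\<close>

lemma alarm_probability:
  fixes \<xi> :: "nat \<Rightarrow> 'w \<Rightarrow> 'a::euclidean_space"
  assumes "prob_space M"
    and indep: "prob_space.indep_vars M (\<lambda>_. borel) \<xi> UNIV"
    and mgf: "\<And>n. gaussian_mgf M (\<xi> n)"
    and fin: "finite (Proj k X)"
  shows "measure M {\<omega>\<in>space M. (\<lambda>n. \<xi> n \<omega>) \<in> alarm X k} \<le> card (Proj k X) * exp (- min_energy X k / 8)"
proof -
  interpret prob_space M by fact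
  have meas[measurable]: "\<xi> n \<in> borel_measurable M" for n
    using indep by (auto simp: indep_vars_def)
  note borel_measurable_correlation[of \<xi> M, OF meas, measurable]
  let ?A = "\<lambda>p. {\<omega>\<in>space M. energy k p / 2 \<le> correlation k p (\<lambda>n. \<xi> n \<omega>)}"
  have "{\<omega>\<in>space M. (\<lambda>n. \<xi> n \<omega>) \<in> alarm X k} = (\<Union>p\<in>Proj k X. ?A p)"
    by (auto simp: alarm_def)
  moreover have "measure M (\<Union>p\<in>Proj k X. ?A p) \<le> (\<Sum>p\<in>Proj k X. measure M (?A p))"
    using fin by (intro finite_measure_subadditive_finite) auto
  moreover have "measure M (?A p) \<le> exp (- min_energy X k / 8)" if p: "p \<in> Proj k X" for p
  proof -
    have "min_energy X k \<le> energy k p"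
      using p by (auto simp: Proj_def energy_restrict intro: min_energy_le)
    then have "exp (- energy k p / 8) \<le> exp (- min_energy X k / 8)" by simp
    then show ?thesis
      using correlation_tail[OF assms(1-3), of k p] by linarith
  qed
  ultimately show ?thesis
    using sum_bounded_above[of "Proj k X" "\<lambda>p. measure M (?A p)" "exp (- min_energy X k / 8)"] by simp
qed

text \<open>Only the true projection is tested. A miss forces the correlation of \<open>x\<close>
  with the noise below minus half the energy, which is the tail event for \<open>-x\<close>.\<close>

lemma miss_probability:
  fixes \<xi> :: "nat \<Rightarrow> 'w \<Rightarrow> 'a::euclidean_space"
  assumes "prob_space M"
    and indep: "prob_space.indep_vars M (\<lambda>_. borel) \<xi> UNIV"
    and mgf: "\<And>n. gaussian_mgf M (\<xi> n)"
    and x: "x \<in> X"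
  shows "measure M {\<omega>\<in>space M. (\<lambda>n. x n + \<xi> n \<omega>) \<notin> alarm X k} \<le> exp (- min_energy X k / 8)"
proof -
  interpret prob_space M by fact
  have meas[measurable]: "\<xi> n \<in> borel_measurable M" for n
    using indep by (auto simp: indep_vars_def)
  note borel_measurable_correlation[of \<xi> M, OF meas, measurable]
  let ?B = "{\<omega>\<in>space M. energy k (\<lambda>n. - x n) / 2 \<le> correlation k (\<lambda>n. - x n) (\<lambda>n. \<xi> n \<omega>)}"
  have "restrict x {..<k} \<in> Proj k X" using x by (auto simp: Proj_def)
  then have "(\<lambda>n. x n + \<xi> n \<omega>) \<in> alarm X k" if "energy k x / 2 \<le> energy k x + correlation k x (\<lambda>n. \<xi> n \<omega>)" for \<omega>
    unfolding alarm_def using that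
    by (auto intro!: bexI[of _ "restrict x {..<k}"] simp: energy_restrict correlation_restrict correlation_add_self)
  then have "{\<omega>\<in>space M. (\<lambda>n. x n + \<xi> n \<omega>) \<notin> alarm X k} \<subseteq> ?B"
    by (auto simp: energy_minus correlation_minus) (smt (verit))
  then have "measure M {\<omega>\<in>space M. (\<lambda>n. x n + \<xi> n \<omega>) \<notin> alarm X k} \<le> measure M ?B"
    by (intro finite_measure_mono) auto
  also have "\<dots> \<le> exp (- energy k x / 8)"
    using correlation_tail[OF assms(1-3), of k "\<lambda>n. - x n"] by (simp add: energy_minus)
  also have "\<dots> \<le> exp (- min_energy X k / 8)"
    using min_energy_le[OF x, of k] by simp
  finally show ?thesis .
qed

section \<open>Borel-Cantelli and the final test\<close>

lemma (in prob_space) AE_eventually_not: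
  assumes "\<And>j. {\<omega>\<in>space M. P j \<omega>} \<in> events"
    and bound: "\<And>j::nat. prob {\<omega>\<in>space M. P j \<omega>} \<le> exp (- real j)"
  shows "AE \<omega> in M. \<forall>\<^sub>F j in sequentially. \<not> P j \<omega>"
proof -
  have "summable (\<lambda>j. exp (- 1 :: real) ^ j)"
    by (rule summable_geometric) simp
  then have "summable (\<lambda>j. exp (- real j))"
    by (simp add: exp_of_nat_mult[symmetric])
  then have "summable (\<lambda>j. prob {\<omega>\<in>space M. P j \<omega>})"
    by (rule summable_comparison_test[rotated]) (use bound in auto)
  from borel_cantelli_AE1[OF assms(1) _ this] show ?thesis
    by (auto simp: emeasure_eq_measure elim!: eventually_mono)
qed

theorem admits_detection_if_gaussian_mgf:
  fixes \<xi> :: "nat \<Rightarrow> 'w \<Rightarrow> 'a::euclidean_space"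
  assumes "prob_space M"
    and indep: "prob_space.indep_vars M (\<lambda>_. borel) \<xi> UNIV"
    and mgf: "\<And>n. gaussian_mgf M (\<xi> n)"
    and fin: "\<And>n. finite ((\<lambda>x. x n) ` X)"
    and inf: "\<And>x. x \<in> X \<Longrightarrow> (\<Sum>n. ennreal ((norm (x n))\<^sup>2)) = \<infinity>"
    and ratio: "liminf (entropy_energy_ratio X) < ereal (1/8)"
  shows "admits_detection M \<xi> X"
proof (cases "X = {}")
  case True
  \<comment> \<open>For empty \<open>X\<close> the infimum defining \<open>min_energy\<close>
    carries no information; the constant test 0 works.\<close>
  then show ?thesis
    unfolding admits_detection_def by (intro bexI[of _ "\<lambda>_. 0"]) auto
next
  case False
  interpret prob_space M by fact
  have meas[measurable]: "\<xi> n \<in> borel_measurable M" for n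
    using indep by (auto simp: indep_vars_def)
  note finP = finite_Proj[OF fin]
  obtain c where c: "0 \<le> c" "c < 1/8"
    and freq: "\<exists>\<^sub>F k in sequentially. ln (real (card (Proj k X))) \<le> c * min_energy X k"
    using frequently_small_ratio[OF ratio False _ finP] by auto
  \<comment> \<open>The threshold is chosen so that the error exponent, at most (c - 1/8) times the
    minimal energy, is at most -j. Nothing makes the resulting \<open>k\<close> increasing;
    Borel-Cantelli and the test run over \<open>j\<close>.\<close>
  have "\<exists>k. real j / (1/8 - c) \<le> min_energy X k \<and> ln (real (card (Proj k X))) \<le> c * min_energy X k" for j
    using frequently_large_energy[OF finP False inf c(1) freq] by blast
  then obtain k where k: "\<And>j. real j / (1/8 - c) \<le> min_energy X (k j)"
      "\<And>j. ln (real (card (Proj (k j) X))) \<le> c * min_energy X (k j)"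
    by metis
  have card_pos: "0 < card (Proj i X)" for i
    using finP[of i] False by (auto simp: card_gt_0_iff Proj_def)
  have error: "card (Proj (k j) X) * exp (- min_energy X (k j) / 8) \<le> exp (- real j)" for j
  proof -
    have "card (Proj (k j) X) * exp (- min_energy X (k j) / 8) =
        exp (ln (card (Proj (k j) X)) - min_energy X (k j) / 8)"
      using card_pos[of "k j"] by (simp add: diff_conv_add_uminus exp_add del: add_uminus_conv_diff)
    also have "\<dots> \<le> exp (- real j)"
      using k(1)[of j] k(2)[of j] c(2) by (simp add: field_simps)
    finally show ?thesis .
  qed
  have noise: "prob {\<omega>\<in>space M. (\<lambda>n. \<xi> n \<omega>) \<in> alarm X (k j)} \<le> exp (- real j)" for j
    using alarm_probability[OF assms(1-3) finP] error order_trans by blast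
  have signal: "prob {\<omega>\<in>space M. (\<lambda>n. x n + \<xi> n \<omega>) \<notin> alarm X (k j)} \<le> exp (- real j)" if "x \<in> X" for x j
  proof -
    \<comment> \<open>Since the cardinality is at least 1, the false-alarm bound
      \<open>error\<close> also dominates the miss probability.\<close>
    have "1 * exp (- min_energy X (k j) / 8) \<le> card (Proj (k j) X) * exp (- min_energy X (k j) / 8)"
      using card_pos[of "k j"] by (intro mult_right_mono) (auto simp: Suc_le_eq)
    then show ?thesis
      using miss_probability[OF assms(1-3) that, of "k j"] error[of j] by linarith
  qed
  have alarm_borel[measurable]: "alarm X i \<in> sets borel" for i
    by (intro borel_closed closed_alarm finP)
  have [measurable]: "(\<lambda>\<omega> n. x n + \<xi> n \<omega>) \<in> borel_measurable M" for x
    by (rule measurable_coordinatewise_then_product) measurable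
  have [measurable]: "(\<lambda>\<omega> n. \<xi> n \<omega>) \<in> borel_measurable M"
    by (rule measurable_coordinatewise_then_product) measurable
  define T :: "(nat \<Rightarrow> 'a) \<Rightarrow> nat" where
    "T y = (if \<forall>\<^sub>F j in sequentially. y \<notin> alarm X (k j) then 0 else 1)" for y
  have "T \<in> borel \<rightarrow>\<^sub>M count_space {0, 1}"
    unfolding T_def eventually_sequentially by measurable
  moreover have "AE \<omega> in M. T (\<lambda>n. \<xi> n \<omega>) = 0"
  proof -
    have "AE \<omega> in M. \<forall>\<^sub>F j in sequentially. \<not> (\<lambda>n. \<xi> n \<omega>) \<in> alarm X (k j)"
      by (rule AE_eventually_not[OF _ noise]) measurable
    then show ?thesis by (simp add: T_def)
  qed
  moreover have "AE \<omega> in M. T (\<lambda>n. x n + \<xi> n \<omega>) = 1" if "x \<in> X" for x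
  proof -
    have "AE \<omega> in M. \<forall>\<^sub>F j in sequentially. \<not> (\<lambda>n. x n + \<xi> n \<omega>) \<notin> alarm X (k j)"
      by (rule AE_eventually_not[OF _ signal[OF that]]) measurable
    then show ?thesis
    proof (rule AE_mp, intro AE_I2 impI)
      fix \<omega> assume "\<forall>\<^sub>F j in sequentially. \<not> (\<lambda>n. x n + \<xi> n \<omega>) \<notin> alarm X (k j)"
      \<comment> \<open>Alarms at all large \<open>j\<close> and at no large \<open>j\<close>
        exclude each other because \<open>sequentially\<close> is a nontrivial filter.\<close>
      moreover have False if "\<forall>\<^sub>F j in sequentially. (\<lambda>n. x n + \<xi> n \<omega>) \<notin> alarm X (k j)"
        and "\<forall>\<^sub>F j in sequentially. \<not> (\<lambda>n. x n + \<xi> n \<omega>) \<notin> alarm X (k j)"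
        using eventually_conj[OF that] by simp
      ultimately show "T (\<lambda>n. x n + \<xi> n \<omega>) = 1"
        by (auto simp: T_def)
    qed
  qed
  ultimately show ?thesis
    unfolding admits_detection_def by blast
qed

theorem theorem1p4:
  fixes M :: "'w measure" and \<xi> :: "nat \<Rightarrow> 'w \<Rightarrow> real" and X :: "(nat \<Rightarrow> real) set"
    and N :: "'v measure" and \<zeta> :: "nat \<Rightarrow> 'v \<Rightarrow> complex" and Z :: "(nat \<Rightarrow> complex) set"
  shows
    "(real_gaussian_noise M \<xi> \<and>
      X \<in> sets borel \<and>
      (\<forall>n. finite ((\<lambda>x. x n) ` X)) \<and>
      (\<forall>x\<in>X. (\<Sum>n. ennreal ((norm (x n))\<^sup>2)) = \<infinity>) \<and>
      liminf (entropy_energy_ratio X) < ereal (1/8)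
      \<longrightarrow> admits_detection M \<xi> X) \<and>
     (complex_gaussian_noise N \<zeta> \<and>
      Z \<in> sets borel \<and>
      (\<forall>n. finite ((\<lambda>z. z n) ` Z)) \<and>
      (\<forall>z\<in>Z. (\<Sum>n. ennreal ((norm (z n))\<^sup>2)) = \<infinity>) \<and>
      liminf (entropy_energy_ratio Z) < ereal (1/8)
      \<longrightarrow> admits_detection N \<zeta> Z)"
  unfolding real_gaussian_noise_def complex_gaussian_noise_def
  by (blast intro: admits_detection_if_gaussian_mgf gaussian_mgf_real gaussian_mgf_complex)

end
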